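(* Let $S$ be a complete subordinator whose Laplace exponent $\phi$ has zero killing coefficient and satisfies the following: there exist $\alpha\in(0,2)$ and a measurable function $\ell:(0,\infty)\to(0,\infty)$, locally bounded above and below by positive constants and slowly varying at infinity, such that $\phi(\lambda)\asymp\lambda^{\alpha/2}\ell(\lambda)$ as $\lambda\to\infty$. Then the Lévy density $\mu$ of $S$ satisfies $$\mu(t)\asymp t^{-1}\phi(t^{-1})\asymp t^{-\alpha/2-1}\ell(t^{-1}),\qquad t\to0+.$$
   Context: A $C^\infty$ function $\phi:(0,\infty)\to[0,\infty)$ is a Bernstein function if $(-1)^nD^n\phi\le 0$ for every $n\ge1$; equivalently $\phi(\lambda)=a+b\lambda+\int_{(0,\infty)}(1-e^{-\lambda t})\,\mu(dt)$ with $a,b\ge0$ (killing coefficient, drift) and a measure $\mu$ (Lévy measure) with $\int(1\wedge t)\,\mu(dt)<\infty$. It is a complete Bernstein function if $\mu$ has a completely monotone density; this density is also denoted $\mu(t)$ and called the Lévy density. A subordinator is an increasing Lévy process $S$ on $[0,\infty)$ with $S_0=0$; its Laplace exponent $\phi$ is defined by $\mathbb E[e^{-\lambda S_t}]=e^{-t\phi(\lambda)}$, $\lambda>0$. The subordinator is called complete if $\phi$ is a complete Bernstein function. Standing assumptions: $S$ has no drift and $\lim_{\lambda\to\infty}\phi(\lambda)=\infty$. A function $\ell:(0,\infty)\to(0,\infty)$ is slowly varying at infinity if $\lim_{t\to\infty}\ell(\lambda t)/\ell(t)=1$ for every $\lambda>0$. Convention: $f(\lambda)\asymp g(\lambda)$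 as $\lambda\to\infty$ (resp. $f(t)\asymp g(t)$ as $t\to0+$) means there is a constant $c>1$ with $c^{-1}\le f/g\le c$ on $[1,\infty)$ (resp. on $(0,1]$). *)

theory Defs
  imports "HOL-Probability.Probability"
begin

text \<open>
  Functions on the open half line are represented by total functions on the reals; only their
  values at positive arguments are ever used.  For \<open>x > 0\<close> the iterated derivative
  \<open>(deriv ^^ n) f x\<close> depends only on the values of \<open>f\<close> near \<open>x\<close>.
\<close>

definition smooth_on_pos :: "(real \<Rightarrow> real) \<Rightarrow> bool" where
  "smooth_on_pos f \<longleftrightarrow> (\<forall>n. \<forall>x>0. (deriv ^^ n) f differentiable (at x))"

definition completely_monotone :: "(real \<Rightarrow> real) \<Rightarrow> bool" where
  "completely_monotone f \<longleftrightarrow>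
     smooth_on_pos f \<and> (\<forall>n. \<forall>x>0. (-1) ^ n * (deriv ^^ n) f x \<ge> 0)"

definition bernstein :: "(real \<Rightarrow> real) \<Rightarrow> bool" where
  "bernstein \<phi> \<longleftrightarrow>
     smooth_on_pos \<phi> \<and> (\<forall>x>0. \<phi> x \<ge> 0) \<and>
     (\<forall>n\<ge>1. \<forall>x>0. (-1) ^ n * (deriv ^^ n) \<phi> x \<le> 0)"

definition levy_measure :: "real measure \<Rightarrow> bool" where
  "levy_measure \<mu> \<longleftrightarrow>
     sets \<mu> = sets (restrict_space borel {0<..}) \<and>
     (\<integral>\<^sup>+ t. ennreal (min 1 t) \<partial>\<mu>) < \<infinity>"

text \<open>
  \<open>a\<close> is the killing coefficient, \<open>b\<close> the drift and \<open>\<mu>\<close> the Levy measure of \<open>\<phi>\<close>.  The integrand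
  is bounded by a multiple of \<open>min 1 t\<close>, so the Bochner integral is never a default value.
\<close>

definition bernstein_representation ::
    "(real \<Rightarrow> real) \<Rightarrow> real \<Rightarrow> real \<Rightarrow> real measure \<Rightarrow> bool" where
  "bernstein_representation \<phi> a b \<mu> \<longleftrightarrow>
     a \<ge> 0 \<and> b \<ge> 0 \<and> levy_measure \<mu> \<and>
     (\<forall>x>0. \<phi> x = a + b * x + (LINT t|\<mu>. 1 - exp (- x * t)))"

definition completely_monotone_density :: "real measure \<Rightarrow> (real \<Rightarrow> real) \<Rightarrow> bool" where
  "completely_monotone_density \<mu> m \<longleftrightarrow>
     completely_monotone m \<and> \<mu> = density (restrict_space lborel {0<..}) (\<lambda>t. ennreal (m t))"

definition complete_bernstein :: "(real \<Rightarrow> real) \<Rightarrow> bool" where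
  "complete_bernstein \<phi> \<longleftrightarrow>
     bernstein \<phi> \<and>
     (\<exists>a b \<mu> m. bernstein_representation \<phi> a b \<mu> \<and> completely_monotone_density \<mu> m)"

definition cadlag :: "(real \<Rightarrow> real) \<Rightarrow> bool" where
  "cadlag f \<longleftrightarrow>
     (\<forall>t\<ge>0. continuous (at_right t) f) \<and> (\<forall>t>0. \<exists>l. (f \<longlongrightarrow> l) (at_left t))"

text \<open>Real-valued Levy processes started at 0, with time set \<open>{0..}\<close>.\<close>

definition levy_process :: "'a measure \<Rightarrow> (real \<Rightarrow> 'a \<Rightarrow> real) \<Rightarrow> bool" where
  "levy_process M S \<longleftrightarrow>
     prob_space M \<and>
     (\<forall>t\<ge>0. S t \<in> borel_measurable M) \<and>
     (AE \<omega> in M. S 0 \<omega> = 0) \<and>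
     (\<forall>n (t :: nat \<Rightarrow> real). t 0 \<ge> 0 \<and> strict_mono_on {..n} t \<longrightarrow>
        prob_space.indep_vars M (\<lambda>_. borel) (\<lambda>i \<omega>. S (t (Suc i)) \<omega> - S (t i) \<omega>) {..<n}) \<and>
     (\<forall>s\<ge>0. \<forall>h\<ge>0. distr M borel (\<lambda>\<omega>. S (s + h) \<omega> - S s \<omega>) = distr M borel (S h)) \<and>
     (\<forall>t\<ge>0. \<forall>\<epsilon>>0.
        ((\<lambda>s. measure M {\<omega> \<in> space M. \<bar>S s \<omega> - S t \<omega>\<bar> > \<epsilon>}) \<longlongrightarrow> 0) (at t within {0..})) \<and>
     (AE \<omega> in M. cadlag (\<lambda>t. S t \<omega>))"

definition subordinator :: "'a measure \<Rightarrow> (real \<Rightarrow> 'a \<Rightarrow> real) \<Rightarrow> bool" where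
  "subordinator M S \<longleftrightarrow>
     levy_process M S \<and> (AE \<omega> in M. mono_on {0..} (\<lambda>t. S t \<omega>))"

definition laplace_exponent ::
    "'a measure \<Rightarrow> (real \<Rightarrow> 'a \<Rightarrow> real) \<Rightarrow> (real \<Rightarrow> real) \<Rightarrow> bool" where
  "laplace_exponent M S \<phi> \<longleftrightarrow>
     (\<forall>t\<ge>0. \<forall>x>0. (LINT \<omega>|M. exp (- x * S t \<omega>)) = exp (- t * \<phi> x))"

definition complete_subordinator ::
    "'a measure \<Rightarrow> (real \<Rightarrow> 'a \<Rightarrow> real) \<Rightarrow> (real \<Rightarrow> real) \<Rightarrow> bool" where
  "complete_subordinator M S \<phi> \<longleftrightarrow>
     subordinator M S \<and> laplace_exponent M S \<phi> \<and> complete_bernstein \<phi>"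

definition slowly_varying :: "(real \<Rightarrow> real) \<Rightarrow> bool" where
  "slowly_varying l \<longleftrightarrow> (\<forall>x>0. ((\<lambda>t. l (x * t) / l t) \<longlongrightarrow> 1) at_top)"

definition locally_bounded_above_below :: "(real \<Rightarrow> real) \<Rightarrow> bool" where
  "locally_bounded_above_below l \<longleftrightarrow>
     (\<forall>K. compact K \<and> K \<subseteq> {0<..} \<longrightarrow> (\<exists>c>0. \<exists>C>0. \<forall>x\<in>K. c \<le> l x \<and> l x \<le> C))"

text \<open>
  Two-sided comparability on a set; as \<open>x / 0 = 0\<close>, it fails when \<open>g\<close> vanishes somewhere on \<open>A\<close>.
  Comparability at infinity and at \<open>0+\<close> mean comparability on all of \<open>{1..}\<close> and of \<open>{0<..1}\<close>.
\<close>

definition comparable_on :: "real set \<Rightarrow> (real \<Rightarrow> real) \<Rightarrow> (real \<Rightarrow> real) \<Rightarrow> bool" where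
  "comparable_on A f g \<longleftrightarrow> (\<exists>c>1. \<forall>x\<in>A. inverse c \<le> f x / g x \<and> f x / g x \<le> c)"

abbreviation comparable_at_infinity :: "(real \<Rightarrow> real) \<Rightarrow> (real \<Rightarrow> real) \<Rightarrow> bool" where
  "comparable_at_infinity \<equiv> comparable_on {1..}"

abbreviation comparable_at_zero :: "(real \<Rightarrow> real) \<Rightarrow> (real \<Rightarrow> real) \<Rightarrow> bool" where
  "comparable_at_zero \<equiv> comparable_on {0<..1}"

end

theory Submission
  imports Defs
begin

text \<open>
  Write \<open>\<phi>(x) = \<integral> (1 - e\<^sup>-\<^sup>x\<^sup>u) m(u) du\<close>. The second comparability is the hypothesis on \<open>\<phi>\<close> read at
  \<open>x = 1/t\<close>; the content is the comparison of \<open>m(t)\<close> with \<open>\<phi>(1/t)/t\<close>. The kernel at \<open>x\<close> is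
  \<open>min 1 (x u)\<close> up to a factor \<open>e\<close>.

  The upper bound for \<open>m\<close> comes from its monotonicity: on \<open>(t/2, t]\<close> the kernel at \<open>1/t\<close> is
  bounded below and \<open>m \<ge> m(t)\<close>, so this interval alone contributes a multiple of \<open>t m(t)\<close> to
  \<open>\<phi>(1/t)\<close> (\<open>density_upper_bound\<close>).

  For the lower bound, fix \<open>d < 1\<close> and split the integral for \<open>\<phi>(x)\<close> at \<open>u = d/x\<close> and \<open>u = 1/(d x)\<close>.
  On the first part the kernel at \<open>x\<close> is at most \<open>e d\<close> times the kernel at \<open>x/d\<close>, and on the last part
  at most \<open>e\<close> times the kernel at \<open>d x\<close>, while on the middle part \<open>m \<le> m(d/x)\<close>. Hence
  \<open>\<phi>(x) \<le> e d \<phi>(x/d) + e \<phi>(d x) + m(d/x)/(d x)\<close> (\<open>exponent_three_scales\<close>).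
  Regular variation with index \<open>\<beta> = \<alpha>/2\<close> strictly between 0 and 1 makes the first two terms at most
  a constant times \<open>d\<^sup>1\<^sup>-\<^sup>\<beta> \<phi>(x)\<close> and \<open>d\<^sup>\<beta> \<phi>(x)\<close> for large \<open>x\<close>; with \<open>d\<close> small they
  are absorbed by the left-hand side, and the third term is at least \<open>\<phi>(x)/2\<close>. As \<open>d\<close> is chosen once and
  for all, slow variation enters only through the two scaling factors \<open>1/d\<close> and \<open>d\<close>.

  This settles all small \<open>t\<close>. On the remaining compact part of \<open>(0, 1]\<close> the bound follows from
  monotonicity together with \<open>m(1) > 0\<close>, which holds because a completely monotone function with a
  single zero vanishes identically (\<open>completely_monotone_zero_everywhere\<close>).
\<close>

section \<open>Completely monotone functions\<close>

lemma completely_monotone_nonneg: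
  assumes "completely_monotone f" and "x > 0"
  shows "f x \<ge> 0"
  using assms unfolding completely_monotone_def by (metis funpow_0 mult_1 power_0)

lemma completely_monotone_has_derivative:
  assumes "completely_monotone f" and "x > 0"
  shows "((deriv ^^ n) f has_real_derivative (deriv ^^ Suc n) f x) (at x)"
  using assms unfolding completely_monotone_def smooth_on_pos_def
  by (simp add: DERIV_deriv_iff_real_differentiable)

text \<open>
  Expanding around the right end point turns every term of Taylor's formula into a nonnegative one,
  because \<open>(x - y)\<^sup>k\<close> carries the sign \<open>(-1)\<^sup>k\<close>.
\<close>

lemma completely_monotone_taylor:
  assumes f: "completely_monotone f" and x: "0 < x" "x < y" and n: "n > 0"
  obtains z where "x < z" "z < y"
    "f x = (\<Sum>k<n. (-1) ^ k * (deriv ^^ k) f y / fact k * (y - x) ^ k)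
             + (-1) ^ n * (deriv ^^ n) f z / fact n * (y - x) ^ n"
proof -
  have "\<exists>z>x. z < y \<and> f x = (\<Sum>k<n. (deriv ^^ k) f y / fact k * (x - y) ^ k)
             + (deriv ^^ n) f z / fact n * (x - y) ^ n"
    using n x by (intro Taylor_down[where b = y])
      (auto intro: completely_monotone_has_derivative[OF f, unfolded funpow.simps o_def])
  moreover have "(x - y) ^ k = (-1) ^ k * (y - x) ^ k" for k
    by (simp flip: power_mult_distrib)
  ultimately show thesis
    using that by (auto simp: mult_ac)
qed

text \<open>
  A Cauchy-type estimate: a single term of a Taylor sum of nonnegative terms, with nonnegative
  remainder, is at most the whole.
\<close>

lemma completely_monotone_derivative_bound:
  assumes f: "completely_monotone f" and x: "0 < x" "x < y"
  shows "(-1) ^ k * (deriv ^^ k) f y / fact k * (y - x) ^ k \<le> f x"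
proof -
  have nonneg: "0 \<le> (-1) ^ j * (deriv ^^ j) f z / fact j * (y - x) ^ j" if "z > 0" for j z
    using f x that unfolding completely_monotone_def
    by (intro mult_nonneg_nonneg[OF divide_nonneg_nonneg]) auto
  obtain z where z: "x < z" and eq:
    "f x = (\<Sum>j<Suc k. (-1) ^ j * (deriv ^^ j) f y / fact j * (y - x) ^ j)
             + (-1) ^ Suc k * (deriv ^^ Suc k) f z / fact (Suc k) * (y - x) ^ Suc k"
    using completely_monotone_taylor[OF f x, of "Suc k"] by blast
  have "(-1) ^ k * (deriv ^^ k) f y / fact k * (y - x) ^ k
      \<le> (\<Sum>j<Suc k. (-1) ^ j * (deriv ^^ j) f y / fact j * (y - x) ^ j)"
    using x by (intro member_le_sum nonneg) auto
  moreover have "0 \<le> (-1) ^ Suc k * (deriv ^^ Suc k) f z / fact (Suc k) * (y - x) ^ Suc k"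
    using x z by (intro nonneg) auto
  ultimately show ?thesis
    using eq by linarith
qed

lemma completely_monotone_antimono:
  assumes "completely_monotone f" and "0 < x" "x \<le> y"
  shows "f y \<le> f x"
  using completely_monotone_derivative_bound[of f x y 0] assms by (cases "x = y") auto

text \<open>
  This is analytic continuation, made quantitative. To the right of a zero all derivatives vanish,
  so the Taylor expansion of \<open>f\<close> around \<open>4 w > s\<close> consists of the remainder only. The
  derivative bound with base point \<open>w\<close> shows that the remainder at \<open>3 w\<close> decays geometrically: the
  point of expansion is at distance \<open>w\<close> from \<open>3 w\<close>, the base point at distance \<open>2 w\<close>. The value of
  \<open>w\<close> is chosen so that \<open>3 w < s < 4 w\<close>, which moves the zero to the left.
\<close>

lemma completely_monotone_zero_step:
  assumes f: "completely_monotone f" and s: "s > 0" and zero: "f s = 0"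
  shows "f (9 / 10 * s) = 0"
proof -
  define w where "w = 3 / 10 * s"
  have w: "w > 0" "s < 4 * w" and x: "9 / 10 * s = 3 * w"
    using s by (simp_all add: w_def)
  have flat: "(-1) ^ k * (deriv ^^ k) f (4 * w) = 0" for k
  proof -
    have "(-1) ^ k * (deriv ^^ k) f (4 * w) / fact k * (4 * w - s) ^ k \<le> 0"
      using completely_monotone_derivative_bound[OF f s w(2), of k] zero by simp
    moreover have "(4 * w - s) ^ k / fact k > 0"
      using w by simp
    ultimately have "(-1) ^ k * (deriv ^^ k) f (4 * w) \<le> 0"
      by (metis mult.commute mult_le_0_iff not_less times_divide_eq_left times_divide_eq_right)
    moreover have "(-1) ^ k * (deriv ^^ k) f (4 * w) \<ge> 0"
      using f w unfolding completely_monotone_def by simp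
    ultimately show ?thesis
      by linarith
  qed
  have bound: "f (3 * w) \<le> (1 / 2) ^ n * f w" if n: "n > 0" for n
  proof -
    obtain z where z: "3 * w < z" and eq:
      "f (3 * w) = (\<Sum>k<n. (-1) ^ k * (deriv ^^ k) f (4 * w) / fact k * (4 * w - 3 * w) ^ k)
             + (-1) ^ n * (deriv ^^ n) f z / fact n * (4 * w - 3 * w) ^ n"
      by (rule completely_monotone_taylor[OF f, of "3 * w" "4 * w" n]) (use w n in auto)
    have "(-1) ^ n * (deriv ^^ n) f z / fact n * (2 * w) ^ n
        \<le> (-1) ^ n * (deriv ^^ n) f z / fact n * (z - w) ^ n"
      using f w z unfolding completely_monotone_def
      by (intro mult_left_mono power_mono divide_nonneg_pos) auto
    also have "\<dots> \<le> f w"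
      using w z by (intro completely_monotone_derivative_bound[OF f]) auto
    finally have le: "(-1) ^ n * (deriv ^^ n) f z / fact n * (2 * w) ^ n \<le> f w" .
    have "f (3 * w) = (1 / 2) ^ n * ((-1) ^ n * (deriv ^^ n) f z / fact n * (2 * w) ^ n)"
      unfolding eq flat by (simp add: power_mult_distrib power_divide)
    also have "\<dots> \<le> (1 / 2) ^ n * f w"
      by (intro mult_left_mono le) auto
    finally show ?thesis .
  qed
  have "(\<lambda>n. (1 / 2) ^ n * f w) \<longlonglongrightarrow> 0 * f w"
    by (intro tendsto_intros LIMSEQ_realpow_zero) auto
  then have "f (3 * w) \<le> 0"
    using bound by (intro LIMSEQ_le_const[where X = "\<lambda>n. (1 / 2) ^ n * f w"]) (auto intro!: exI[of _ 1])
  then show ?thesis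
    using completely_monotone_nonneg[OF f, of "3 * w"] w unfolding x by linarith
qed

text \<open>
  Iterating the previous step produces zeros arbitrarily close to 0, and \<open>f\<close> is nonnegative and
  nonincreasing.
\<close>

lemma completely_monotone_zero_everywhere:
  assumes f: "completely_monotone f" and s: "s > 0" "f s = 0" and t: "t > 0"
  shows "f t = 0"
proof -
  have zeros: "f ((9 / 10) ^ n * s) = 0" for n
  proof (induction n)
    case (Suc n)
    then show ?case
      using completely_monotone_zero_step[OF f, of "(9 / 10) ^ n * s"] s by (simp add: mult.assoc)
  qed (use s in simp)
  obtain n where "(9 / 10) ^ n < t / s"
    using real_arch_pow_inv[of "t / s" "9 / 10"] s t by auto
  then have "(9 / 10) ^ n * s \<le> t"
    using s by (simp add: field_simps)
  then have "f t \<le> f ((9 / 10) ^ n * s)"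
    using s by (intro completely_monotone_antimono[OF f]) auto
  then show ?thesis
    using zeros[of n] completely_monotone_nonneg[OF f t] by simp
qed

section \<open>Two-sided estimates for the kernel \<open>1 - exp (- v)\<close>\<close>

lemma one_minus_exp_ge_min:
  assumes "v \<ge> 0"
  shows "min 1 v \<le> exp 1 * (1 - exp (- v :: real))"
proof (cases "v \<le> 1")
  case True
  have "v \<le> exp v - 1"
    using exp_ge_add_one_self[of v] by linarith
  also have "\<dots> = exp v * (1 - exp (- v))"
    by (simp add: algebra_simps flip: exp_add)
  also have "\<dots> \<le> exp 1 * (1 - exp (- v))"
    using True assms by (intro mult_right_mono) auto
  finally show ?thesis
    using True by simp
next
  case False
  have "1 \<le> exp 1 - (1 :: real)"
    using exp_ge_add_one_self[of 1] by linarith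
  also have "\<dots> = exp 1 * (1 - exp (- 1))"
    by (simp add: algebra_simps flip: exp_add)
  also have "\<dots> \<le> exp 1 * (1 - exp (- v))"
    using False by (intro mult_left_mono) auto
  finally show ?thesis
    using False by simp
qed

lemma one_minus_exp_le_min: "1 - exp (- v :: real) \<le> min 1 v"
  using exp_ge_add_one_self[of "- v"] by simp

text \<open>
  The three summands dominate the kernel on \<open>v \<le> d\<close>, on \<open>v > 1 / d\<close> and in between, respectively.
  Stating the split pointwise turns the decomposition of \<open>\<phi>\<close> into a single comparison of integrals.
\<close>

lemma one_minus_exp_scale:
  assumes "0 < d" "d < 1" "v \<ge> 0"
  shows "1 - exp (- v :: real)
    \<le> exp 1 * d * (1 - exp (- (v / d))) + exp 1 * (1 - exp (- (d * v)))
        + indicator {d<..1 / d} v"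
proof -
  have pos: "0 \<le> exp 1 * d * (1 - exp (- (v / d)))" "0 \<le> exp 1 * (1 - exp (- (d * v)))"
    using assms by auto
  consider "v \<le> d" | "v \<in> {d<..1 / d}" | "v > 1 / d"
    by fastforce
  then show ?thesis
  proof cases
    case 1
    have "1 - exp (- v) \<le> d * min 1 (v / d)"
      using one_minus_exp_le_min[of v] 1 assms by (simp add: min_def field_simps split: if_splits)
    also have "\<dots> \<le> d * (exp 1 * (1 - exp (- (v / d))))"
      using assms by (intro mult_left_mono one_minus_exp_ge_min) auto
    finally show ?thesis
      using pos by (simp add: mult_ac indicator_def)
  next
    case 2
    then show ?thesis
      using pos exp_gt_zero[of "- v"]
      by (simp only: indicator_simps)
  next
    case 3
    have "1 - exp (- v) \<le> min 1 (d * v)"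
      using 3 assms by (simp add: field_simps)
    also have "\<dots> \<le> exp 1 * (1 - exp (- (d * v)))"
      using assms by (intro one_minus_exp_ge_min) auto
    finally show ?thesis
      using pos by (simp add: indicator_def)
  qed
qed

section \<open>Bernstein functions and their Levy densities\<close>

abbreviation half_line :: "real measure" where
  "half_line \<equiv> restrict_space lborel {0<..}"

lemma half_line_interval:
  assumes "0 \<le> p" "p \<le> q"
  shows "integrable half_line (indicator {p<..q} :: real \<Rightarrow> real)"
    and "(LINT u|half_line. indicator {p<..q} u) = q - p"
proof -
  have sub: "{p<..q} \<inter> {0<..} = {p<..q}"
    using assms by auto
  have "{p<..q} \<in> sets half_line"
    using assms by (auto simp: sets_restrict_space image_iff intro!: bexI[of _ "{p<..q}"])
  moreover have "emeasure half_line {p<..q} = ennreal (q - p)"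
    using assms by (subst emeasure_restrict_space) auto
  ultimately show "integrable half_line (indicator {p<..q} :: real \<Rightarrow> real)"
    and "(LINT u|half_line. indicator {p<..q} u) = q - p"
    using assms by (auto simp: measure_def space_restrict_space sub)
qed

lemma completely_monotone_measurable:
  assumes "completely_monotone f"
  shows "f \<in> borel_measurable half_line"
proof -
  have "continuous_on {0<..} f"
    using completely_monotone_has_derivative[OF assms, of _ 0]
    by (auto intro!: continuous_at_imp_continuous_on dest: DERIV_isCont)
  then have "f \<in> borel_measurable (restrict_space borel {0<..})"
    by (rule borel_measurable_continuous_on_restrict)
  then show ?thesis
    by (simp add: measurable_def space_restrict_space sets_restrict_space)
qed

locale driftless_exponent =
  fixes \<phi> :: "real \<Rightarrow> real" and \<mu> :: "real measure" and m :: "real \<Rightarrow> real"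
  assumes representation: "bernstein_representation \<phi> 0 0 \<mu>"
    and density: "completely_monotone_density \<mu> m"
begin

lemma cm: "completely_monotone m"
  using density by (simp add: completely_monotone_density_def)

lemma m_antimono: "0 < s \<Longrightarrow> s \<le> t \<Longrightarrow> m t \<le> m s"
  using completely_monotone_antimono[OF cm] .

lemma m_nonneg: "0 < t \<Longrightarrow> 0 \<le> m t"
  using completely_monotone_nonneg[OF cm] .

lemma
  assumes x: "x > 0"
  shows kernel_integrable: "integrable half_line (\<lambda>t. m t * (1 - exp (- x * t)))"
    and exponent_eq: "\<phi> x = (LINT t|half_line. m t * (1 - exp (- x * t)))"
proof -
  have \<mu>: "\<mu> = density half_line (\<lambda>t. ennreal (m t))"
    using density by (simp add: completely_monotone_density_def)
  have [measurable]: "m \<in> borel_measurable half_line"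
    by (rule completely_monotone_measurable[OF cm])
  have meas: "(\<lambda>t. h t) \<in> borel_measurable half_line" if "h \<in> borel_measurable borel"
    for h :: "real \<Rightarrow> real"
    using that by (intro measurable_restrict_space1) simp
  have k [measurable]: "(\<lambda>t. 1 - exp (- x * t)) \<in> borel_measurable half_line"
    by (intro meas) simp
  have ae: "AE t in half_line. 0 \<le> m t"
    by (intro AE_I2) (auto simp: space_restrict_space intro: m_nonneg)
  have lm: "(\<integral>\<^sup>+ t. ennreal (min 1 t) \<partial>\<mu>) < \<infinity>"
    using representation by (simp add: bernstein_representation_def levy_measure_def)
  (* The kernel inherits integrability from the Levy condition, as it is at most
     max 1 x * min 1 t. *)
  have "integrable \<mu> (\<lambda>t. min 1 t)"
  proof (rule integrableI_nonneg)
    show "(\<lambda>t. min 1 t) \<in> borel_measurable \<mu>"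
      unfolding \<mu> by (simp, intro meas) simp
    show "AE t in \<mu>. 0 \<le> min 1 t"
      unfolding \<mu> by (intro AE_I2) (auto simp: space_restrict_space)
  qed (rule lm)
  then have "integrable \<mu> (\<lambda>t. max 1 x * min 1 t)"
    by simp
  then have "integrable \<mu> (\<lambda>t. 1 - exp (- x * t))"
  proof (rule Bochner_Integration.integrable_bound)
    show "(\<lambda>t. 1 - exp (- x * t)) \<in> borel_measurable \<mu>"
      unfolding \<mu> using k by simp
    show "AE t in \<mu>. norm (1 - exp (- x * t)) \<le> norm (max 1 x * min 1 t)"
      unfolding \<mu>
    proof (intro AE_I2)
      fix t assume "t \<in> space (density half_line (\<lambda>t. ennreal (m t)))"
      then have t: "t > 0"
        by (simp add: space_restrict_space)
      have "1 - exp (- x * t) \<le> min 1 (x * t)"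
        using one_minus_exp_le_min[of "x * t"] by simp
      also have "\<dots> \<le> max 1 x * min 1 t"
      proof (cases "t \<le> 1")
        case True
        then have "x * t \<le> max 1 x * t" using t by (intro mult_right_mono) auto
        then show ?thesis using True by simp
      next
        case False
        then show ?thesis by (simp add: min.coboundedI1 le_max_iff_disj)
      qed
      finally show "norm (1 - exp (- x * t)) \<le> norm (max 1 x * min 1 t)"
        using x t by simp
    qed
  qed
  then show "integrable half_line (\<lambda>t. m t * (1 - exp (- x * t)))"
    using ae k unfolding \<mu> by (subst (asm) integrable_density) auto
  have "\<phi> x = (LINT t|\<mu>. 1 - exp (- x * t))"
    using representation x by (simp add: bernstein_representation_def)
  also have "\<dots> = (LINT t|half_line. m t * (1 - exp (- x * t)))"
    using ae k unfolding \<mu> by (subst integral_density) auto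
  finally show "\<phi> x = (LINT t|half_line. m t * (1 - exp (- x * t)))" .
qed

lemma exponent_mono:
  assumes "0 < x" "x \<le> y"
  shows "\<phi> x \<le> \<phi> y"
proof -
  have "(LINT t|half_line. m t * (1 - exp (- x * t)))
      \<le> (LINT t|half_line. m t * (1 - exp (- y * t)))"
    using assms by (intro integral_mono kernel_integrable)
      (auto simp: space_restrict_space intro!: mult_left_mono mult_right_mono m_nonneg)
  then show ?thesis
    using assms exponent_eq[of x] exponent_eq[of y] by simp
qed

text \<open>
  On \<open>(t/2, t]\<close> the density is at least \<open>m t\<close> and the kernel at \<open>1/t\<close> is at least \<open>1/(2e)\<close>. The
  interval starts at \<open>t/2\<close> rather than 0 so that the kernel has a constant lower bound there.
\<close>

lemma density_upper_bound:
  assumes t: "t > 0"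
  shows "m t \<le> 4 * exp 1 * (\<phi> (inverse t) / t)"
proof -
  define x where "x = inverse t"
  have x: "x > 0" "x * t = 1"
    using t by (simp_all add: x_def)
  have "(LINT u|half_line. m t / 2 * indicator {t / 2<..t} u)
      \<le> (LINT u|half_line. exp 1 * (m u * (1 - exp (- x * u))))"
  proof (intro integral_mono integrable_mult_right kernel_integrable half_line_interval)
    fix u assume "u \<in> space half_line"
    then have u: "u > 0"
      by (simp add: space_restrict_space)
    show "m t / 2 * indicator {t / 2<..t} u \<le> exp 1 * (m u * (1 - exp (- x * u)))"
    proof (cases "u \<in> {t / 2<..t}")
      case True
      then have "1 / 2 \<le> x * u" "x * u \<le> 1"
        using x mult_left_mono[of "t / 2" u x] mult_left_mono[of u t x] by auto
      then have half: "1 / 2 \<le> exp 1 * (1 - exp (- x * u))"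
        using one_minus_exp_ge_min[of "x * u"] by (simp add: min_def)
      have "m t * (1 / 2) \<le> m u * (exp 1 * (1 - exp (- x * u)))"
        using True u by (intro mult_mono half m_antimono m_nonneg) auto
      then show ?thesis
        using True by (simp add: mult_ac)
    next
      case False
      then show ?thesis
        using u x m_nonneg[OF u] by simp
    qed
  qed (use t x in auto)
  then have "m t / 2 * (t - t / 2) \<le> exp 1 * \<phi> x"
    using t unfolding exponent_eq[OF x(1)] integral_mult_right_zero
    by (subst (asm) half_line_interval(2)) auto
  then show ?thesis
    using t by (simp add: x_def field_simps)
qed

text \<open>
  The basic inequality for the lower bound: \<open>\<phi>\<close> at one scale is controlled by
  \<open>\<phi>\<close> at a larger and a smaller scale, up to a term containing a single value of the density.
\<close>

lemma exponent_three_scales: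
  assumes d: "0 < d" "d < 1" and x: "x > 0"
  shows "\<phi> x \<le> exp 1 * d * \<phi> (x / d) + exp 1 * \<phi> (d * x) + m (d / x) / (d * x)"
proof -
  let ?J = "{d / x<..1 / (d * x)}"
  have J: "0 \<le> d / x" "d / x \<le> 1 / (d * x)"
    using d x mult_le_one[of d d] by (auto simp: field_simps)
  have xd: "x / d > 0" "d * x > 0"
    using d x by auto
  note int = kernel_integrable[OF x] kernel_integrable[OF xd(1)]
    kernel_integrable[OF xd(2)] half_line_interval(1)[OF J]
  have "\<phi> x = (LINT u|half_line. m u * (1 - exp (- x * u)))"
    by (rule exponent_eq[OF x])
  also have "\<dots> \<le> (LINT u|half_line. exp 1 * d * (m u * (1 - exp (- (x / d) * u)))
      + exp 1 * (m u * (1 - exp (- (d * x) * u))) + m (d / x) * indicator ?J u)"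
  proof (intro integral_mono Bochner_Integration.integrable_add integrable_mult_right int)
    fix u assume "u \<in> space half_line"
    then have u: "u > 0"
      by (simp add: space_restrict_space)
    have "m u * (1 - exp (- (x * u)))
        \<le> m u * (exp 1 * d * (1 - exp (- (x * u / d))) + exp 1 * (1 - exp (- (d * (x * u))))
            + indicator {d<..1 / d} (x * u))"
      using d u x by (intro mult_left_mono one_minus_exp_scale m_nonneg) auto
    moreover have "m u * indicator {d<..1 / d} (x * u) \<le> m (d / x) * indicator ?J u"
    proof (cases "x * u \<in> {d<..1 / d}")
      case True
      then have "u \<in> ?J"
        using d x by (auto simp: field_simps)
      then show ?thesis
        using True d x by (auto intro!: m_antimono)
    next
      case False
      then show ?thesis
        using d x m_nonneg[of "d / x"] by simp
    qed
    ultimately show "m u * (1 - exp (- x * u))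
        \<le> exp 1 * d * (m u * (1 - exp (- (x / d) * u)))
          + exp 1 * (m u * (1 - exp (- (d * x) * u))) + m (d / x) * indicator ?J u"
      by (simp add: algebra_simps)
  qed
  also have "\<dots> = exp 1 * d * \<phi> (x / d) + exp 1 * \<phi> (d * x) + m (d / x) * (1 / (d * x) - d / x)"
    unfolding exponent_eq[OF xd(1)] exponent_eq[OF xd(2)]
      half_line_interval(2)[OF J, symmetric] integral_mult_right_zero[symmetric]
    by (subst Bochner_Integration.integral_add,
        intro Bochner_Integration.integrable_add integrable_mult_right int,
        intro integrable_mult_right int,
        subst Bochner_Integration.integral_add,
        intro integrable_mult_right int, intro integrable_mult_right int, rule refl)
  also have "\<dots> \<le> exp 1 * d * \<phi> (x / d) + exp 1 * \<phi> (d * x) + m (d / x) * (1 / (d * x))"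
    using d x by (intro add_left_mono mult_left_mono m_nonneg) auto
  finally show ?thesis
    by simp
qed

lemma density_pos:
  assumes "x > 0" "\<phi> x > 0" and t: "t > 0"
  shows "m t > 0"
proof (rule ccontr)
  assume "\<not> m t > 0"
  then have "m t = 0"
    using m_nonneg[OF t] by simp
  (* A zero of m would make the exponent vanish identically. *)
  then have "m u = 0" if "u > 0" for u
    using completely_monotone_zero_everywhere[OF cm t _ that] by simp
  then have "\<phi> x = (LINT u|half_line. 0)"
    unfolding exponent_eq[OF assms(1)]
    by (intro Bochner_Integration.integral_cong) (auto simp: space_restrict_space)
  then show False
    using assms by simp
qed

text \<open>
  The scaling hypothesis is used twice: it absorbs two of the three terms of
  \<open>exponent_three_scales\<close> at \<open>x = d/t\<close>, and it passes from \<open>\<phi>(d/t)\<close> back to \<open>\<phi>(1/t)\<close>. The number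
  \<open>s\<close> is such that \<open>d/t\<close> lies in the range of the hypothesis for all \<open>t \<le> s\<close>; on \<open>[s, 1]\<close>
  both sides are compared with their values at the end points.
\<close>

lemma density_lower_bound:
  assumes d: "0 < d" "d < 1"
    and scaling: "eventually (\<lambda>x. 4 * exp 1 * d * \<phi> (x / d) \<le> \<phi> x \<and>
                                   4 * exp 1 * \<phi> (d * x) \<le> \<phi> x) at_top"
    and pos: "\<phi> 1 > 0"
  obtains C where "C > 0" "\<And>t. 0 < t \<Longrightarrow> t \<le> 1 \<Longrightarrow> \<phi> (inverse t) / t \<le> C * m t"
proof -
  obtain r where r: "\<And>x. x \<ge> r \<Longrightarrow> 4 * exp 1 * d * \<phi> (x / d) \<le> \<phi> x \<and>
                                   4 * exp 1 * \<phi> (d * x) \<le> \<phi> x"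
    using scaling unfolding eventually_at_top_linorder by blast
  define s where "s = d / max 1 r"
  have s: "s > 0" "s \<le> 1"
    using d by (auto simp: s_def field_simps)
  have small: "\<phi> (inverse t) / t \<le> 1 / (2 * exp 1 * d ^ 3) * m t" if t: "0 < t" "t \<le> s" for t
  proof -
    define x where "x = d / t"
    have x: "x > 0" "d / x = t" "x / d = inverse t" "x * t = d"
      using t d by (auto simp: x_def field_simps)
    have "t * max 1 r \<le> d"
      using t(2) by (simp add: s_def pos_le_divide_eq)
    then have "max 1 r \<le> x"
      by (simp only: x_def pos_le_divide_eq[OF t(1)] mult.commute)
    then have scale: "4 * exp 1 * d * \<phi> (inverse t) \<le> \<phi> x" "4 * exp 1 * \<phi> (d * x) \<le> \<phi> x"
      using r[of x] x by auto
    have "\<phi> x \<le> exp 1 * d * \<phi> (inverse t) + exp 1 * \<phi> (d * x) + m t / (d * x)"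
      using exponent_three_scales[OF d x(1)] x by simp
    then have "2 * exp 1 * d * \<phi> (inverse t) \<le> m t / (d * x)"
      using scale by linarith
    also have "\<dots> = m t * t / d ^ 2"
      using t d by (simp add: x_def field_simps power2_eq_square)
    finally show ?thesis
      using t d by (simp add: field_simps power2_eq_square power3_eq_cube)
  qed
  have m1: "m 1 > 0"
    using density_pos[of 1] pos by simp
  have large: "\<phi> (inverse t) / t \<le> \<phi> (inverse s) / s / m 1 * m t" if t: "s \<le> t" "t \<le> 1" for t
  proof -
    have "\<phi> (inverse t) \<le> \<phi> (inverse s)"
      using s t by (intro exponent_mono) auto
    moreover have "0 < \<phi> (inverse t)"
      using exponent_mono[of 1 "inverse t"] pos s t by (simp add: one_le_inverse)
    ultimately have le: "\<phi> (inverse t) / t \<le> \<phi> (inverse s) / s" "0 < \<phi> (inverse s) / s"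
      using s t by (auto intro!: frac_le)
    have "\<phi> (inverse s) / s * 1 \<le> \<phi> (inverse s) / s * (m t / m 1)"
      using m1 le s t m_antimono[of t 1] by (intro mult_left_mono) auto
    then show ?thesis
      using le by simp
  qed
  define C where "C = max (1 / (2 * exp 1 * d ^ 3)) (\<phi> (inverse s) / s / m 1)"
  show thesis
  proof
    show "C > 0"
      using d by (simp add: C_def less_max_iff_disj)
    fix t :: real assume t: "0 < t" "t \<le> 1"
    have "\<phi> (inverse t) / t \<le> 1 / (2 * exp 1 * d ^ 3) * m t \<or>
          \<phi> (inverse t) / t \<le> \<phi> (inverse s) / s / m 1 * m t"
      using small large t by (cases "t \<le> s") auto
    moreover have "1 / (2 * exp 1 * d ^ 3) * m t \<le> C * m t"
      and "\<phi> (inverse s) / s / m 1 * m t \<le> C * m t"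
      using t by (auto simp only: C_def intro!: mult_right_mono m_nonneg)
    ultimately show "\<phi> (inverse t) / t \<le> C * m t"
      by linarith
  qed
qed

end

section \<open>Regular variation\<close>

text \<open>
  A weak form of Potter's bounds. The constant does not depend on \<open>\<kappa>\<close>, but the threshold from which
  the estimate holds does: for one \<open>\<kappa>\<close> at a time it only matters that \<open>l(\<kappa> x)/l(x)\<close> is
  eventually below 2.
\<close>

lemma regular_variation_scaling:
  assumes l: "\<And>x. x > 0 \<Longrightarrow> l x > 0" "slowly_varying l"
    and comparable: "comparable_at_infinity \<phi> (\<lambda>x. x powr \<beta> * l x)"
  obtains D where "D > 0"
    "\<And>\<kappa>. \<kappa> > 0 \<Longrightarrow> eventually (\<lambda>x. \<phi> (\<kappa> * x) \<le> D * \<kappa> powr \<beta> * \<phi> x) at_top"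
proof -
  obtain c where c: "c > 1" "\<And>x. x \<ge> 1 \<Longrightarrow> inverse c \<le> \<phi> x / (x powr \<beta> * l x)"
    "\<And>x. x \<ge> 1 \<Longrightarrow> \<phi> x / (x powr \<beta> * l x) \<le> c"
    using comparable unfolding comparable_on_def by auto
  have upper: "\<phi> x \<le> c * (x powr \<beta> * l x)" and lower: "x powr \<beta> * l x \<le> c * \<phi> x"
    if "x \<ge> 1" for x
    using c(2,3)[OF that] l(1)[of x] c(1) that by (simp_all add: field_simps)
  show thesis
  proof
    show "2 * c\<^sup>2 > 0"
      using c by simp
    fix \<kappa> :: real assume \<kappa>: "\<kappa> > 0"
    have "((\<lambda>x. l (\<kappa> * x) / l x) \<longlongrightarrow> 1) at_top"
      using l(2) \<kappa> by (simp add: slowly_varying_def)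
    then have "eventually (\<lambda>x. l (\<kappa> * x) / l x < 2) at_top"
      by (rule order_tendstoD) simp
    moreover have "eventually (\<lambda>x. x \<ge> max 1 (1 / \<kappa>)) at_top"
      by (rule eventually_ge_at_top)
    ultimately show "eventually (\<lambda>x. \<phi> (\<kappa> * x) \<le> 2 * c\<^sup>2 * \<kappa> powr \<beta> * \<phi> x) at_top"
    proof eventually_elim
      case (elim x)
      have x: "x \<ge> 1" "\<kappa> * x \<ge> 1"
        using elim(2) \<kappa> by (auto simp: field_simps)
      have ratio: "l (\<kappa> * x) \<le> 2 * l x"
        using elim(1) l(1)[of x] x by (simp add: field_simps)
      have "\<phi> (\<kappa> * x) \<le> c * ((\<kappa> * x) powr \<beta> * l (\<kappa> * x))"
        by (rule upper[OF x(2)])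
      also have "\<dots> \<le> c * ((\<kappa> * x) powr \<beta> * (2 * l x))"
        using c ratio by (intro mult_left_mono) auto
      also have "\<dots> = 2 * c * \<kappa> powr \<beta> * (x powr \<beta> * l x)"
        using \<kappa> x by (simp add: powr_mult)
      also have "\<dots> \<le> 2 * c * \<kappa> powr \<beta> * (c * \<phi> x)"
        using c lower[OF x(1)] by (intro mult_left_mono) auto
      finally show ?case
        by (simp add: power2_eq_square mult_ac)
    qed
  qed
qed

text \<open>
  Scaling by \<open>1/d\<close> costs \<open>d\<^sup>-\<^sup>\<beta>\<close>, which the prefactor \<open>d\<close> more than compensates if \<open>\<beta> < 1\<close>;
  scaling by \<open>d\<close> gains \<open>d\<^sup>\<beta>\<close>, which is small if \<open>\<beta> > 0\<close>. Both \<open>d\<^sup>1\<^sup>-\<^sup>\<beta>\<close> and \<open>d\<^sup>\<beta>\<close> are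
  at most \<open>d\<^sup>\<gamma>\<close> with \<open>\<gamma> = min \<beta> (1 - \<beta>)\<close>, and \<open>d\<close> is chosen so that \<open>d\<^sup>\<gamma> = 1/B\<close> beats the constants.
\<close>

lemma regular_variation_small_scale:
  assumes \<beta>: "0 < \<beta>" "\<beta> < 1"
    and pos: "eventually (\<lambda>x. \<phi> x \<ge> 0) at_top"
    and D: "D > 0" "\<And>\<kappa>. \<kappa> > 0 \<Longrightarrow> eventually (\<lambda>x. \<phi> (\<kappa> * x) \<le> D * \<kappa> powr \<beta> * \<phi> x) at_top"
    and A: "A > 0"
  obtains d :: real where "0 < d" "d < 1"
    "eventually (\<lambda>x. A * d * \<phi> (x / d) \<le> \<phi> x \<and> A * \<phi> (d * x) \<le> \<phi> x) at_top"
proof -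
  define \<gamma> where "\<gamma> = min \<beta> (1 - \<beta>)"
  define B where "B = max 2 (A * D)"
  define d where "d = B powr (- (1 / \<gamma>))"
  have \<gamma>: "\<gamma> > 0" "\<gamma> \<le> \<beta>" "\<gamma> \<le> 1 - \<beta>"
    using \<beta> by (auto simp: \<gamma>_def)
  have B: "B > 1" "A * D \<le> B"
    by (auto simp: B_def)
  have d: "0 < d" "d < 1"
    using B \<gamma> powr_less_mono[of "- (1 / \<gamma>)" 0 B] by (auto simp: d_def)
  have gain: "A * D * d powr p \<le> 1" if "\<gamma> \<le> p" for p
  proof -
    have "d powr p \<le> d powr \<gamma>"
      using d that by (intro powr_mono') auto
    also have "\<dots> = inverse B"
      using B \<gamma> unfolding d_def powr_powr by (simp add: powr_minus)
    finally have "A * D * d powr p \<le> B * inverse B"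
      using A D B by (intro mult_mono) auto
    then show ?thesis
      using B by simp
  qed
  have "eventually (\<lambda>x. A * d * \<phi> (x / d) \<le> \<phi> x \<and> A * \<phi> (d * x) \<le> \<phi> x) at_top"
    using pos D(2)[of "1 / d", OF divide_pos_pos[OF zero_less_one d(1)]] D(2)[OF d(1)]
  proof eventually_elim
    case (elim x)
    have le: "A * D * d powr p * \<phi> x \<le> \<phi> x" if "\<gamma> \<le> p" for p
      using mult_right_mono[OF gain[OF that] elim(1)] by simp
    have split: "d powr (1 - \<beta>) = d * (1 / d) powr \<beta>"
      using d by (simp add: powr_diff powr_divide)
    have "A * d * \<phi> (1 / d * x) \<le> A * d * (D * (1 / d) powr \<beta> * \<phi> x)"
      using A d by (intro mult_left_mono elim(2)) simp
    also have "A * d * (D * (1 / d) powr \<beta> * \<phi> x) = A * D * d powr (1 - \<beta>) * \<phi> x"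
      unfolding split by (simp only: mult_ac)
    also have "\<dots> \<le> \<phi> x"
      by (rule le[OF \<gamma>(3)])
    finally have "A * d * \<phi> (x / d) \<le> \<phi> x"
      by simp
    moreover have "A * \<phi> (d * x) \<le> A * (D * d powr \<beta> * \<phi> x)"
      using A by (intro mult_left_mono elim(3)) simp
    then have "A * \<phi> (d * x) \<le> \<phi> x"
      using le[OF \<gamma>(2)] by (simp only: mult.assoc)
    ultimately show ?case
      by (rule conjI)
  qed
  with d show thesis
    by (rule that)
qed

section \<open>Comparability of the density\<close>

theorem theorem2p10:
  fixes M :: "'a measure" and S :: "real \<Rightarrow> 'a \<Rightarrow> real"
    and \<phi> :: "real \<Rightarrow> real" and a b :: real and \<mu> :: "real measure" and m :: "real \<Rightarrow> real"
    and \<alpha> :: real and l :: "real \<Rightarrow> real"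
  assumes "complete_subordinator M S \<phi>"
    and "bernstein_representation \<phi> a b \<mu>"
    and "completely_monotone_density \<mu> m"
    and "a = 0"
    and "b = 0"
    and "filterlim \<phi> at_top at_top"
    and "0 < \<alpha>" and "\<alpha> < 2"
    and "\<And>x. x > 0 \<Longrightarrow> l x > 0"
    and "l \<in> borel_measurable (lebesgue_on {0<..})"
    and "locally_bounded_above_below l"
    and "slowly_varying l"
    and "comparable_at_infinity \<phi> (\<lambda>x. x powr (\<alpha> / 2) * l x)"
  shows "comparable_at_zero m (\<lambda>t. inverse t * \<phi> (inverse t)) \<and>
         comparable_at_zero (\<lambda>t. inverse t * \<phi> (inverse t))
           (\<lambda>t. t powr (- \<alpha> / 2 - 1) * l (inverse t))"
proof
  interpret driftless_exponent \<phi> \<mu> m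
    using assms by unfold_locales auto
  obtain k where k: "k > 1"
    "\<And>x. x \<ge> 1 \<Longrightarrow> inverse k \<le> \<phi> x / (x powr (\<alpha> / 2) * l x)"
    "\<And>x. x \<ge> 1 \<Longrightarrow> \<phi> x / (x powr (\<alpha> / 2) * l x) \<le> k"
    using assms(13) unfolding comparable_on_def by auto
  have pos: "\<phi> x > 0" if "x \<ge> 1" for x
  proof -
    have "0 < \<phi> x / (x powr (\<alpha> / 2) * l x)"
      using k(1) k(2)[OF that] by (meson inverse_positive_iff_positive less_le_trans less_trans zero_less_one)
    then show ?thesis
      using that assms(9)[of x] by (simp add: zero_less_divide_iff) (metis less_asym mult_nonneg_nonneg not_less powr_ge_zero less_imp_le)
  qed
  obtain D where D: "D > 0"
    "\<And>\<kappa>. \<kappa> > 0 \<Longrightarrow> eventually (\<lambda>x. \<phi> (\<kappa> * x) \<le> D * \<kappa> powr (\<alpha> / 2) * \<phi> x) at_top"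
    using regular_variation_scaling[OF assms(9,12,13)] by blast
  have "eventually (\<lambda>x. \<phi> x \<ge> 0) at_top"
    using eventually_ge_at_top[of 1] by eventually_elim (simp add: pos less_imp_le)
  then obtain d where d: "0 < d" "d < 1"
    "eventually (\<lambda>x. 4 * exp 1 * d * \<phi> (x / d) \<le> \<phi> x \<and> 4 * exp 1 * \<phi> (d * x) \<le> \<phi> x) at_top"
    using regular_variation_small_scale[of "\<alpha> / 2" \<phi> D "4 * exp 1"] D assms(7,8) by auto
  obtain C where C: "C > 0" "\<And>t. 0 < t \<Longrightarrow> t \<le> 1 \<Longrightarrow> \<phi> (inverse t) / t \<le> C * m t"
    using density_lower_bound[OF d] pos[of 1] by auto
  show "comparable_at_zero m (\<lambda>t. inverse t * \<phi> (inverse t))"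
    unfolding comparable_on_def
  proof (intro exI[of _ "max C (4 * exp 1)"] conjI ballI)
    show "1 < max C (4 * exp 1)"
      using exp_ge_add_one_self[of 1] by linarith
    fix t :: real assume "t \<in> {0<..1}"
    then have t: "0 < t" "t \<le> 1"
      by auto
    have q: "0 < inverse t * \<phi> (inverse t)"
      using t pos[of "inverse t"] by (simp add: one_le_inverse)
    have "inverse t * \<phi> (inverse t) \<le> C * m t"
      using C(2)[OF t] by (simp add: field_simps)
    also have "\<dots> \<le> max C (4 * exp 1) * m t"
      using t by (intro mult_right_mono m_nonneg) auto
    finally show "inverse (max C (4 * exp 1)) \<le> m t / (inverse t * \<phi> (inverse t))"
      using C(1) unfolding pos_le_divide_eq[OF q] inverse_eq_divide[of "max C _"]
      by (simp add: pos_divide_le_eq less_max_iff_disj mult.commute)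
    have "m t \<le> 4 * exp 1 * (inverse t * \<phi> (inverse t))"
      using density_upper_bound[OF t(1)] by (simp add: field_simps)
    also have "\<dots> \<le> max C (4 * exp 1) * (inverse t * \<phi> (inverse t))"
      using q by (intro mult_right_mono) auto
    finally show "m t / (inverse t * \<phi> (inverse t)) \<le> max C (4 * exp 1)"
      using q by (simp add: pos_divide_le_eq)
  qed
  show "comparable_at_zero (\<lambda>t. inverse t * \<phi> (inverse t))
          (\<lambda>t. t powr (- \<alpha> / 2 - 1) * l (inverse t))"
    unfolding comparable_on_def
  proof (intro exI[of _ k] conjI ballI)
    fix t :: real assume "t \<in> {0<..1}"
    then have t: "0 < t" "inverse t \<ge> 1"
      by (auto simp: one_le_inverse)
    have "t powr (- \<alpha> / 2 - 1) = t powr (- (\<alpha> / 2)) / t powr 1"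
      by (simp only: powr_diff[symmetric] minus_divide_left)
    also have "\<dots> = inverse t * inverse t powr (\<alpha> / 2)"
      using t by (simp only: powr_minus powr_one inverse_powr divide_inverse mult.commute less_imp_le)
    finally have "inverse t * \<phi> (inverse t) / (t powr (- \<alpha> / 2 - 1) * l (inverse t))
        = \<phi> (inverse t) / (inverse t powr (\<alpha> / 2) * l (inverse t))"
      using t by simp
    then show "inverse k \<le> inverse t * \<phi> (inverse t) / (t powr (- \<alpha> / 2 - 1) * l (inverse t))"
      and "inverse t * \<phi> (inverse t) / (t powr (- \<alpha> / 2 - 1) * l (inverse t)) \<le> k"
      using k(2,3)[OF t(2)] by simp_all
  qed (rule k(1))
qed

end
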